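(* Let $\{x_k\}$ be a sequence generated by the Sublinear Contracting PPA (defined in the context) with $\mu\in(0,1)$ and $\beta>0$. Then $\{x_k\}$ converges weakly to a solution of the inclusion $0\in Tx$.
   Context: $\mathcal H$ is a real Hilbert space with inner product $\langle\cdot,\cdot\rangle$ and norm $\|\cdot\|$. $T$ is a (set-valued) maximally monotone operator on $\mathcal H$ such that $T^{-1}(0)=\{x:0\in Tx\}$ is nonempty and bounded. For $\lambda>0$, $J_{\lambda T}=(I+\lambda T)^{-1}$ and $T_\lambda=\frac1\lambda(I-J_{\lambda T})$ is the (single-valued) Yosida regularization. Sublinear Contracting PPA: given $\mu\in[0,1)$, $p\ge1$, $\tau_{-1}\in(0,1]$, $x_{-1}=x_0\in\mathcal H$, set for $k\ge0$ $$\tau_k=\frac{1}{ak+1}\quad\Big(0<a\le\frac{1-\mu}{p}\Big),\qquad v_k=\frac{1}{\tau_{k-1}}x_k-\frac{1-\tau_{k-1}}{\tau_{k-1}}x_{k-1}.$$ Given $\lambda>0$, $\beta\ge0$ and $\delta_k\ge0$ with $\sum_{k\ge0}\delta_k<+\infty$, for $k=0,1,\dots$ find $x_{k+1}$ such that $$0=\frac{1}{\tau_k^p}T_\lambda(x_{k+1})-\frac{1-\tau_k}{\tau_k^p}T_\lambda(x_k)+(v_{k+1}-v_k)+\beta(x_{k+1}-x_k)+g_k,$$ where $g_k\in\mathcal H$ satisfies $\|g_k\|\le\delta_k$. *)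

theory Defs
  imports "HOL-Analysis.Analysis"
begin

text \<open>Set-valued operators on \<open>'a\<close> are functions \<open>'a \<Rightarrow> 'a set\<close>.\<close>

definition op_inverse :: "('a \<Rightarrow> 'a set) \<Rightarrow> 'a \<Rightarrow> 'a set" where
  "op_inverse T y = {x. y \<in> T x}"

definition monotone_operator :: "('a::real_inner \<Rightarrow> 'a set) \<Rightarrow> bool" where
  "monotone_operator T \<longleftrightarrow>
     (\<forall>x y. \<forall>u\<in>T x. \<forall>w\<in>T y. 0 \<le> (x - y) \<bullet> (u - w))"

definition maximally_monotone :: "('a::real_inner \<Rightarrow> 'a set) \<Rightarrow> bool" where
  "maximally_monotone T \<longleftrightarrow> monotone_operator T \<and>
     (\<forall>S. monotone_operator S \<and> (\<forall>x. T x \<subseteq> S x) \<longrightarrow> S = T)"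

text \<open>The set-valued inverse of \<open>I + lam T\<close> is everywhere defined and single-valued when
  \<open>T\<close> is maximally monotone on a Hilbert space and \<open>lam > 0\<close> (Minty), so the description
  below denotes its unique value; in other situations it is unspecified.\<close>

definition resolvent :: "real \<Rightarrow> ('a::real_inner \<Rightarrow> 'a set) \<Rightarrow> 'a \<Rightarrow> 'a" where
  "resolvent lam T x = (THE y. y \<in> op_inverse (\<lambda>z. {z + lam *\<^sub>R u | u. u \<in> T z}) x)"

definition yosida :: "real \<Rightarrow> ('a::real_inner \<Rightarrow> 'a set) \<Rightarrow> 'a \<Rightarrow> 'a" where
  "yosida lam T x = (1 / lam) *\<^sub>R (x - resolvent lam T x)"

text \<open>The sequences start at index \<open>-1\<close>: \<open>prev c f k\<close> is the entry with index \<open>k - 1\<close>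
  of the sequence whose entry at \<open>-1\<close> is \<open>c\<close> and whose later entries are given by \<open>f\<close>.\<close>

fun prev :: "'b \<Rightarrow> (nat \<Rightarrow> 'b) \<Rightarrow> nat \<Rightarrow> 'b" where
  "prev c f 0 = c"
| "prev c f (Suc k) = f k"

definition ppa_tau :: "real \<Rightarrow> nat \<Rightarrow> real" where
  "ppa_tau a k = 1 / (a * real k + 1)"

definition ppa_v ::
  "real \<Rightarrow> real \<Rightarrow> 'a::real_inner \<Rightarrow> (nat \<Rightarrow> 'a) \<Rightarrow> nat \<Rightarrow> 'a" where
  "ppa_v a tau_m1 x_m1 x k =
     (let t = prev tau_m1 (ppa_tau a) k
      in (1 / t) *\<^sub>R x k - ((1 - t) / t) *\<^sub>R prev x_m1 x k)"

definition sublinear_contracting_ppa ::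
  "('a::real_inner \<Rightarrow> 'a set) \<Rightarrow> real \<Rightarrow> real \<Rightarrow> real \<Rightarrow> real \<Rightarrow> real \<Rightarrow> real \<Rightarrow>
   (nat \<Rightarrow> real) \<Rightarrow> (nat \<Rightarrow> 'a) \<Rightarrow> 'a \<Rightarrow> (nat \<Rightarrow> 'a) \<Rightarrow> bool" where
  "sublinear_contracting_ppa T mu p a tau_m1 lam beta delta g x_m1 x \<longleftrightarrow>
     0 \<le> mu \<and> mu < 1 \<and> 1 \<le> p \<and> 0 < a \<and> a \<le> (1 - mu) / p \<and>
     0 < tau_m1 \<and> tau_m1 \<le> 1 \<and> 0 < lam \<and> 0 \<le> beta \<and>
     (\<forall>k. 0 \<le> delta k) \<and> summable delta \<and> (\<forall>k. norm (g k) \<le> delta k) \<and>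
     x_m1 = x 0 \<and>
     (\<forall>k. 0 = (1 / ppa_tau a k powr p) *\<^sub>R yosida lam T (x (Suc k))
            - ((1 - ppa_tau a k) / ppa_tau a k powr p) *\<^sub>R yosida lam T (x k)
            + (ppa_v a tau_m1 x_m1 x (Suc k) - ppa_v a tau_m1 x_m1 x k)
            + beta *\<^sub>R (x (Suc k) - x k) + g k)"

definition converges_weakly :: "(nat \<Rightarrow> 'a::real_inner) \<Rightarrow> 'a \<Rightarrow> bool" where
  "converges_weakly x z \<longleftrightarrow> (\<forall>y. (\<lambda>k. x k \<bullet> y) \<longlonglongrightarrow> z \<bullet> y)"

end

theory Submission
  imports Defs "HOL-Real_Asymp.Real_Asymp"
begin

text \<open>
  Two independent facts combine. The algorithm side is a decay argument in discrete time; the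
  operator side is Minty's surjectivity theorem and a form of Opial's lemma.

  The algorithm. Put \<open>A k = yosida lam T (x k)\<close>, \<open>d k = x (k+1) - x k\<close> and \<open>u k = v k - x k\<close>,
  so that \<open>u (k+1) = a * k * d k\<close>. With \<open>r k = (a * k + 1) powr (p - 1)\<close>, \<open>q k = a * k * r k\<close> and
  \<open>Y k = u k + q k * A k\<close> the iteration reads
  \<open>Y (k+1) - Y k = - (eps k * A (k+1) + (1 + beta) * d k + g k)\<close>,
  where the step-size condition on \<open>a\<close> guarantees
  \<open>mu * r (k+1) \<le> eps k \<le> r (k+1)\<close>. Three quasi-decreasing energies are extracted by pairing the
  iteration with three different vectors.
  \<^item> Pairing with \<open>v (k+1) - z\<close>, for a zero \<open>z\<close> of \<open>T\<close>, shows that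
    \<open>E k = \<parallel>v k - z\<parallel>^2 / 2 + beta \<parallel>x k - z\<parallel>^2 / 2 + q k \<langle>x k - z, A k\<rangle>\<close> converges. Positivity of
    \<open>mu\<close> and \<open>beta\<close> gives \<open>\<Sum> \<parallel>A k\<parallel>^2 < \<infinity>\<close> and \<open>\<Sum> (k+1) \<parallel>d k\<parallel>^2 < \<infinity>\<close>, and \<open>x\<close> is bounded.
  \<^item> Pairing with \<open>Y (k+1)\<close> shows that \<open>\<parallel>Y k\<parallel>\<close> converges and
    \<open>\<Sum> (k+1) r (k+1)^2 \<parallel>A (k+1)\<parallel>^2 < \<infinity>\<close>.
  \<^item> Pairing with \<open>u (k+1)\<close> then shows that \<open>\<parallel>u k\<parallel>\<close> converges.

  The sums bound \<open>\<Sum> \<parallel>u k\<parallel>^2 / k\<close> and \<open>\<Sum> \<parallel>Y k\<parallel>^2 / k\<close>, and the harmonic series diverges, so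
  \<open>u\<close> and \<open>Y\<close> tend to zero. Since
  \<open>E k = (1 + beta) \<parallel>x k - z\<parallel>^2 / 2 + \<langle>Y k, x k - z\<rangle> + \<parallel>u k\<parallel>^2 / 2\<close>, the distance of
  \<open>x k\<close> to every zero of \<open>T\<close> converges.

  The operator. Minty's theorem makes the Yosida regularization well defined and cocoercive, and together with
  \<open>A k \<longlonglongrightarrow> 0\<close> and maximality it makes every weak cluster point of \<open>x\<close> a zero of \<open>T\<close>. Opial's
  lemma concludes. Both Minty's theorem and the existence of weak cluster points come
  from the same source: almost-minimizers of a strongly convex quadratic over a convex set,
  or over a decreasing sequence of convex sets, form a Cauchy sequence.
\<close>

section \<open>Almost decreasing real sequences\<close>

lemma convergent_if_almost_decreasing:
  fixes E b c :: "nat \<Rightarrow> real"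
  assumes E: "\<And>k. 0 \<le> E k" and b: "\<And>k. 0 \<le> b k" and c: "\<And>k. 0 \<le> c k"
    and sc: "summable c"
    and step: "\<And>k. E (Suc k) + b k \<le> E k + c k"
  shows "convergent E" and "summable b"
proof -
  have tel: "E n + (\<Sum>k<n. b k) \<le> E 0 + (\<Sum>k<n. c k)" for n
  proof (induction n)
    case (Suc n)
    then show ?case using step[of n] by simp
  qed simp
  have "(\<Sum>k<n. b k) \<le> E 0 + suminf c" for n
    using tel[of n] E[of n] sum_le_suminf[OF sc, of "{..<n}"] c by force
  then have "(\<Sum>k\<le>n. b k) \<le> E 0 + suminf c" for n
    by (metis lessThan_Suc_atMost)
  then show sb: "summable b"
    using b by (intro bounded_imp_summable[where B = "E 0 + suminf c"])
  define F where "F n = E n + (\<Sum>k<n. b k) - (\<Sum>k<n. c k)" for n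
  have "F (Suc n) \<le> F n" for n
    using step[of n] by (simp add: F_def)
  moreover have "- suminf c \<le> F n" for n
    using E[of n] sum_nonneg[of "{..<n}" b] b c sum_le_suminf[OF sc, of "{..<n}"]
    by (force simp: F_def)
  ultimately obtain L where "F \<longlonglongrightarrow> L"
    using decseq_convergent[of F "- suminf c"] by (metis decseq_Suc_iff)
  then have "(\<lambda>n. F n - (\<Sum>k<n. b k) + (\<Sum>k<n. c k)) \<longlonglongrightarrow> L - suminf b + suminf c"
    by (intro tendsto_intros summable_LIMSEQ sb sc)
  then show "convergent E"
    by (auto simp: F_def convergent_def)
qed

text \<open>
  An error \<open>delta k\<close> in the iteration enters an energy estimate multiplied by a norm that the new
  energy itself controls. Such a perturbation grows only like the square root of the energy,
  so it cannot outrun a summable \<open>delta\<close>: the energy stays bounded, and after that the perturbation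
  is summable.
\<close>

lemma convergent_if_almost_decreasing_sqrt:
  fixes E b c delta w :: "nat \<Rightarrow> real"
  assumes w: "\<And>k. 0 \<le> w k" "\<And>k. (w k)\<^sup>2 \<le> 2 * E k"
    and b: "\<And>k. 0 \<le> b k" and c: "\<And>k. 0 \<le> c k" and delta: "\<And>k. 0 \<le> delta k"
    and sc: "summable c" and sd: "summable delta"
    and step: "\<And>k. E (Suc k) + b k \<le> E k + c k + delta k * w (Suc k)"
  shows "convergent E" and "summable b"
proof -
  have E: "0 \<le> E k" for k
    using w(2)[of k] zero_le_power2[of "w k"] by linarith
  define C where "C = suminf c"
  define D where "D = suminf delta"
  have D0: "0 \<le> D" "0 \<le> C"
    unfolding C_def D_def using sd sc delta c by (auto intro: suminf_nonneg)
  \<comment> \<open>A first index with \<open>w n > M\<close> would satisfy \<open>(w n)\<^sup>2 \<le> 2 (E 0 + C + D * w n)\<close>,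
    which fails for this \<open>M\<close> because \<open>w n > 1\<close>.\<close>
  define M where "M = 1 + 2 * E 0 + 2 * C + 2 * D"
  have M1: "1 \<le> M" using E[of 0] D0 by (simp add: M_def)
  have tel: "E n \<le> E 0 + (\<Sum>k<n. c k) + (\<Sum>k<n. delta k * w (Suc k))" for n
  proof (induction n)
    case (Suc n)
    then show ?case using step[of n] b[of n] by simp
  qed simp
  have wM: "w n \<le> M" for n
  proof (induction n rule: less_induct)
    case (less n)
    show ?case
    proof (rule ccontr)
      assume "\<not> w n \<le> M"
      then have gt: "M < w n" by simp
      have "w (Suc k) \<le> w n" if "k < n" for k
        using less[of "Suc k"] gt that by (cases "Suc k = n") (auto simp: less_Suc_eq)
      then have "(\<Sum>k<n. delta k * w (Suc k)) \<le> (\<Sum>k<n. delta k * w n)"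
        by (intro sum_mono mult_left_mono delta) auto
      also have "\<dots> = (\<Sum>k<n. delta k) * w n"
        by (simp add: sum_distrib_right)
      also have "\<dots> \<le> D * w n"
        unfolding D_def using sum_le_suminf[OF sd, of "{..<n}"] delta w(1)
        by (intro mult_right_mono) auto
      finally have "E n \<le> E 0 + C + D * w n"
        using tel[of n] sum_le_suminf[OF sc, of "{..<n}"] c by (force simp: C_def)
      then have "(w n)\<^sup>2 \<le> (2 * E 0 + 2 * C) * 1 + 2 * D * w n"
        using w(2)[of n] by simp
      also have "\<dots> \<le> (2 * E 0 + 2 * C) * w n + 2 * D * w n"
        using gt M1 E[of 0] D0 by (intro add_right_mono mult_left_mono) auto
      also have "\<dots> < M * w n"
        using gt M1 by (simp add: M_def algebra_simps)
      also have "\<dots> \<le> w n * w n"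
        using gt M1 by (intro mult_right_mono) auto
      finally show False by (simp add: power2_eq_square)
    qed
  qed
  have step': "E (Suc k) + b k \<le> E k + (c k + delta k * M)" for k
    using step[of k] mult_left_mono[OF wM[of "Suc k"] delta[of k]] by simp
  have "summable (\<lambda>k. c k + delta k * M)"
    by (intro summable_add sc summable_mult2 sd)
  moreover have "0 \<le> c k + delta k * M" for k
    using c delta M1 by simp
  ultimately show "convergent E" "summable b"
    using convergent_if_almost_decreasing[of E b "\<lambda>k. c k + delta k * M"] E b step' by blast+
qed

text \<open>A positive limit would make the harmonic series converge.\<close>

lemma tendsto_zero_if_summable_over_index:
  fixes f :: "nat \<Rightarrow> real"
  assumes conv: "convergent f" and nn: "\<And>k. 0 \<le> f k"
    and s: "summable (\<lambda>k. f k / real (Suc k))"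
  shows "f \<longlonglongrightarrow> 0"
proof -
  obtain l where l: "f \<longlonglongrightarrow> l" using conv by (auto simp: convergent_def)
  then have "0 \<le> l" using nn by (intro LIMSEQ_le_const) auto
  moreover have "\<not> 0 < l"
  proof
    assume "0 < l"
    then have "\<forall>\<^sub>F k in sequentially. l / 2 < f k"
      using l by (intro order_tendstoD) auto
    then have "\<forall>\<^sub>F k in sequentially. norm (1 / real (Suc k)) \<le> (2 / l) * (f k / real (Suc k))"
    proof eventually_elim
      case (elim k)
      then have "1 \<le> 2 / l * f k"
        using \<open>0 < l\<close> by (simp add: field_simps)
      then have "1 / real (Suc k) \<le> 2 / l * f k / real (Suc k)"
        by (intro divide_right_mono) auto
      then show ?case by simp
    qed
    then have "summable (\<lambda>k. 1 / real (Suc k))"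
      by (rule summable_comparison_test_ev) (intro summable_mult s)
    then have "summable (\<lambda>k. 1 / real k)"
      by (subst (asm) summable_Suc_iff)
    then show False
      using not_summable_harmonic[where 'a = real] by (simp add: inverse_eq_divide)
  qed
  ultimately show ?thesis using l by simp
qed

lemma tendsto_0_if_half_norm_sq:
  fixes f :: "nat \<Rightarrow> 'a::real_normed_vector"
  assumes "convergent (\<lambda>k. (norm (f k))\<^sup>2 / 2)"
    and "summable (\<lambda>k. (norm (f (Suc k)))\<^sup>2 / real (Suc k))"
  shows "f \<longlonglongrightarrow> 0"
proof -
  have "convergent (\<lambda>k. 2 * ((norm (f (Suc k)))\<^sup>2 / 2))"
    using assms(1) by (intro convergent_mult convergent_const) (simp add: convergent_Suc_iff[of "\<lambda>k. (norm (f k))\<^sup>2 / 2"])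
  then have "(\<lambda>k. (norm (f (Suc k)))\<^sup>2) \<longlonglongrightarrow> 0"
    using assms(2) by (intro tendsto_zero_if_summable_over_index) auto
  then have "(\<lambda>k. sqrt ((norm (f (Suc k)))\<^sup>2)) \<longlonglongrightarrow> sqrt 0"
    by (rule tendsto_real_sqrt)
  then have "(\<lambda>k. f (Suc k)) \<longlonglongrightarrow> 0"
    by (simp add: tendsto_norm_zero_iff)
  then show ?thesis by (rule LIMSEQ_imp_Suc)
qed

section \<open>Weak cluster points and Opial's lemma\<close>

lemma Cauchy_if_dist_sq_le:
  fixes f :: "nat \<Rightarrow> 'a::real_normed_vector" and e err :: "nat \<Rightarrow> real"
  assumes e: "convergent e" and err: "err \<longlonglongrightarrow> 0"
    and le: "\<And>n m. n \<le> m \<Longrightarrow> (norm (f m - f n))\<^sup>2 \<le> \<bar>e m - e n\<bar> + err m + err n"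
  shows "Cauchy f"
proof (rule metric_CauchyI)
  fix eps :: real assume eps: "0 < eps"
  then have e3: "0 < eps\<^sup>2 / 3" by simp
  have "Cauchy e" using e by (rule convergent_Cauchy)
  then obtain N1 where N1: "\<And>m n. N1 \<le> m \<Longrightarrow> N1 \<le> n \<Longrightarrow> dist (e m) (e n) < eps\<^sup>2 / 3"
    using e3 by (meson metric_CauchyD)
  obtain N2 where N2: "\<And>n. N2 \<le> n \<Longrightarrow> norm (err n - 0) < eps\<^sup>2 / 3"
    using LIMSEQ_D[OF err e3] by blast
  have key: "dist (f m) (f n) < eps" if "n \<le> m" "max N1 N2 \<le> n" for m n
  proof -
    have "(norm (f m - f n))\<^sup>2 < eps\<^sup>2"
    proof -
      have "\<bar>e m - e n\<bar> < eps\<^sup>2 / 3" "\<bar>err m\<bar> < eps\<^sup>2 / 3" "\<bar>err n\<bar> < eps\<^sup>2 / 3"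
        using N1[of m n] N2[of m] N2[of n] that by (auto simp: dist_real_def)
      then show ?thesis using le[OF that(1)] by linarith
    qed
    then show ?thesis using eps by (simp add: dist_norm power_less_imp_less_base)
  qed
  have "dist (f m) (f n) < eps" if "max N1 N2 \<le> m" "max N1 N2 \<le> n" for m n
    using key[of n m] key[of m n] that by (cases "n \<le> m") (auto simp: dist_commute)
  then show "\<exists>M. \<forall>m\<ge>M. \<forall>n\<ge>M. dist (f m) (f n) < eps" by blast
qed

lemma norm_sq_convex_combination:
  fixes y z :: "'a::real_inner"
  shows "(norm ((1 - t) *\<^sub>R y + t *\<^sub>R z))\<^sup>2
    = (1 - t) * (norm y)\<^sup>2 + t * (norm z)\<^sup>2 - t * (1 - t) * (norm (y - z))\<^sup>2"
  unfolding power2_norm_eq_inner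
  by (simp add: inner_simps inner_commute algebra_simps)

text \<open>
  The conclusion says that \<open>w\<close> lies in every closed half-space that eventually contains the
  sequence. This holds for weak cluster points, and more generally for points of the closed convex
  hulls of all tails; unlike the former, the latter can be found without extracting
  subsequences, as the limit of almost-shortest vectors of the hulls. The squared distances
  of the hulls to the origin increase and are bounded, so the parallelogram law makes
  these vectors a Cauchy sequence.
\<close>

lemma bounded_sequence_weak_cluster_point:
  fixes x :: "nat \<Rightarrow> 'a::{real_inner, complete_space}"
  assumes bnd: "bounded (range x)"
  obtains w where "\<And>y c. \<forall>\<^sub>F k in sequentially. x k \<bullet> y \<le> c \<Longrightarrow> w \<bullet> y \<le> c"
proof -
  define K where "K n = convex hull (x ` {n..})" for n
  have K_anti: "K m \<subseteq> K n" if "n \<le> m" for m n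
    unfolding K_def using that by (intro hull_mono image_mono) auto
  have K_x: "x n \<in> K n" for n
    unfolding K_def by (intro hull_inc) auto
  have K_conv: "convex (K n)" for n
    by (simp add: K_def)
  define e where "e n = Inf ((\<lambda>p. (norm p)\<^sup>2) ` K n)" for n
  have bdd: "bdd_below ((\<lambda>p. (norm p)\<^sup>2) ` K n)" for n
    by (rule bdd_belowI[of _ 0]) auto
  have e_le: "e n \<le> (norm p)\<^sup>2" if "p \<in> K n" for n p
    unfolding e_def using that by (intro cInf_lower bdd) auto
  have "\<exists>p\<in>K n. (norm p)\<^sup>2 < e n + 1 / real (Suc n)" for n
  proof -
    have ne: "(\<lambda>p. (norm p)\<^sup>2) ` K n \<noteq> {}"
      using K_x[of n] by blast
    have lt: "Inf ((\<lambda>p. (norm p)\<^sup>2) ` K n) < e n + 1 / real (Suc n)"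
      by (simp add: e_def)
    show ?thesis
      using cInf_lessD[OF ne lt] by blast
  qed
  then obtain p where pK: "\<And>n. p n \<in> K n"
    and p_lt: "\<And>n. (norm (p n))\<^sup>2 < e n + 1 / real (Suc n)"
    by metis
  obtain B where B: "\<And>n. norm (x n) \<le> B"
    using bnd by (auto simp: bounded_iff)
  have "incseq e"
  proof (rule incseq_SucI)
    fix n
    show "e n \<le> e (Suc n)"
      unfolding e_def[of "Suc n"]
      using K_x[of "Suc n"] K_anti[of n "Suc n"] by (intro cInf_greatest) (auto intro: e_le)
  qed
  moreover have "e n \<le> B\<^sup>2" for n
    using e_le[OF K_x[of n]] power_mono[OF B[of n], of 2] by simp
  ultimately have e_conv: "convergent e"
    using incseq_convergent[of e] by (metis convergent_def)
  have "Cauchy p"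
  proof (rule Cauchy_if_dist_sq_le)
    show "convergent (\<lambda>n. 2 * e n)"
      using e_conv by (intro convergent_mult convergent_const)
    show "(\<lambda>n. 2 * (1 / real (Suc n))) \<longlonglongrightarrow> 0"
      by real_asymp
    fix n m :: nat assume "n \<le> m"
    then have "p m \<in> K n" using pK K_anti by blast
    then have "(1 - 1 / 2) *\<^sub>R p m + (1 / 2) *\<^sub>R p n \<in> K n"
      using pK[of n] by (intro convexD[OF K_conv]) auto
    from e_le[OF this] have "(norm (p m - p n))\<^sup>2
        \<le> 2 * (norm (p m))\<^sup>2 + 2 * (norm (p n))\<^sup>2 - 4 * e n"
      unfolding norm_sq_convex_combination by simp
    then show "(norm (p m - p n))\<^sup>2
        \<le> \<bar>2 * e m - 2 * e n\<bar> + 2 * (1 / real (Suc m)) + 2 * (1 / real (Suc n))"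
      using p_lt[of m] p_lt[of n] by linarith
  qed
  then obtain w where w: "p \<longlonglongrightarrow> w"
    by (meson Cauchy_convergent_iff convergent_def)
  show thesis
  proof
    fix y :: 'a and c :: real
    assume "\<forall>\<^sub>F k in sequentially. x k \<bullet> y \<le> c"
    then obtain N where N: "\<And>k. N \<le> k \<Longrightarrow> x k \<bullet> y \<le> c"
      by (auto simp: eventually_sequentially)
    have "K N \<subseteq> {v. y \<bullet> v \<le> c}"
      unfolding K_def using N by (intro hull_minimal convex_halfspace_le) (auto simp: inner_commute)
    then have "\<forall>n\<ge>N. p n \<bullet> y \<le> c"
      using pK K_anti by (fastforce simp: inner_commute)
    moreover have "(\<lambda>n. p n \<bullet> y) \<longlonglongrightarrow> w \<bullet> y"
      by (intro tendsto_intros w)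
    ultimately show "w \<bullet> y \<le> c"
      by (intro LIMSEQ_le_const2) auto
  qed
qed

lemma weak_cluster_point_eqI:
  fixes w y :: "'a::real_inner"
  assumes w: "\<And>y c. \<forall>\<^sub>F k in sequentially. x k \<bullet> y \<le> c \<Longrightarrow> w \<bullet> y \<le> c"
    and l: "(\<lambda>k. x k \<bullet> y) \<longlonglongrightarrow> l"
  shows "w \<bullet> y = l"
proof (rule antisym)
  show "w \<bullet> y \<le> l"
  proof (rule field_le_epsilon)
    fix e :: real assume "0 < e"
    then have "\<forall>\<^sub>F k in sequentially. x k \<bullet> y < l + e"
      using l by (intro order_tendstoD) auto
    then show "w \<bullet> y \<le> l + e"
      by (intro w) (auto elim: eventually_mono)
  qed
  show "l \<le> w \<bullet> y"
  proof (rule field_le_epsilon)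
    fix e :: real assume "0 < e"
    then have "\<forall>\<^sub>F k in sequentially. l - e < x k \<bullet> y"
      using l by (intro order_tendstoD) auto
    then have "w \<bullet> (- y) \<le> - (l - e)"
      by (intro w) (auto elim: eventually_mono)
    then show "l \<le> w \<bullet> y + e" by simp
  qed
qed

text \<open>
  For two points \<open>z\<close>, \<open>w\<close> of \<open>Z\<close> the difference of the two convergent squared distances is affine
  in \<open>x k\<close>, so \<open>x k \<bullet> (z - w)\<close> converges. If \<open>z\<close> and \<open>w\<close> are generalized cluster points of the
  sequence and of a subsequence, both \<open>z \<bullet> (z - w)\<close> and \<open>w \<bullet> (z - w)\<close> equal that limit,
  and \<open>z = w\<close>. A subsequence that stays weakly away from \<open>z\<close> would have a cluster point
  different from \<open>z\<close>.
\<close>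

lemma opial:
  fixes x :: "nat \<Rightarrow> 'a::{real_inner, complete_space}"
  assumes bnd: "bounded (range x)"
    and dist: "\<And>z. z \<in> Z \<Longrightarrow> convergent (\<lambda>k. (norm (x k - z))\<^sup>2)"
    and clus: "\<And>\<sigma> w. strict_mono \<sigma> \<Longrightarrow>
      (\<And>y c. \<forall>\<^sub>F k in sequentially. x (\<sigma> k) \<bullet> y \<le> c \<Longrightarrow> w \<bullet> y \<le> c) \<Longrightarrow> w \<in> Z"
  shows "\<exists>z\<in>Z. \<forall>y. (\<lambda>k. x k \<bullet> y) \<longlonglongrightarrow> z \<bullet> y"
proof -
  obtain z where z: "\<And>y c. \<forall>\<^sub>F k in sequentially. x k \<bullet> y \<le> c \<Longrightarrow> z \<bullet> y \<le> c"
    using bounded_sequence_weak_cluster_point[OF bnd] by blast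
  have zZ: "z \<in> Z"
    using clus[of id z] z by (simp add: strict_mono_id)
  have upper: "\<forall>\<^sub>F k in sequentially. x k \<bullet> y < z \<bullet> y + e" if e: "0 < e" for y e
  proof (rule ccontr)
    assume "\<not> ?thesis"
    then have "\<exists>\<^sub>F k in sequentially. \<not> (x k \<bullet> y < z \<bullet> y + e)"
      by (simp add: frequently_def)
    then have "infinite {k. \<not> (x k \<bullet> y < z \<bullet> y + e)}"
      by (simp add: frequently_cofinite[symmetric] cofinite_eq_sequentially)
    then obtain \<sigma> :: "nat \<Rightarrow> nat" where \<sigma>: "strict_mono \<sigma>"
      and far: "\<And>k. \<not> (x (\<sigma> k) \<bullet> y < z \<bullet> y + e)"
      using infinite_enumerate[of "{k. \<not> (x k \<bullet> y < z \<bullet> y + e)}"] by blast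
    have "bounded (range (x \<circ> \<sigma>))"
      using bnd by (rule bounded_subset) auto
    then obtain w where
      w: "\<And>y c. \<forall>\<^sub>F k in sequentially. (x \<circ> \<sigma>) k \<bullet> y \<le> c \<Longrightarrow> w \<bullet> y \<le> c"
      using bounded_sequence_weak_cluster_point by blast
    have wZ: "w \<in> Z"
      using clus[OF \<sigma>, of w] w by (simp add: o_def)
    have "convergent (\<lambda>k. ((norm (x k - w))\<^sup>2 - (norm (x k - z))\<^sup>2 - (norm w)\<^sup>2 + (norm z)\<^sup>2) * (1 / 2))"
      by (intro convergent_mult convergent_add convergent_diff convergent_const dist wZ zZ)
    moreover have "((norm (x k - w))\<^sup>2 - (norm (x k - z))\<^sup>2 - (norm w)\<^sup>2 + (norm z)\<^sup>2) * (1 / 2)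
        = x k \<bullet> (z - w)" for k
      unfolding power2_norm_eq_inner by (simp add: inner_simps inner_commute)
    ultimately obtain l where l: "(\<lambda>k. x k \<bullet> (z - w)) \<longlonglongrightarrow> l"
      by (auto simp: convergent_def)
    have "z \<bullet> (z - w) = l"
      using weak_cluster_point_eqI[OF z l] .
    moreover have "w \<bullet> (z - w) = l"
      using LIMSEQ_subseq_LIMSEQ[OF l \<sigma>] by (intro weak_cluster_point_eqI[OF w]) (auto simp: o_def)
    ultimately have "(z - w) \<bullet> (z - w) = 0"
      by (simp add: inner_diff_left)
    then have "w = z" by simp
    moreover have "w \<bullet> (- y) \<le> - (z \<bullet> y + e)"
    proof (intro w always_eventually allI)
      show "(x \<circ> \<sigma>) k \<bullet> (- y) \<le> - (z \<bullet> y + e)" for k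
        using far[of k] by (simp add: not_less)
    qed
    ultimately show False using e by simp
  qed
  have "(\<lambda>k. x k \<bullet> y) \<longlonglongrightarrow> z \<bullet> y" for y
  proof (rule order_tendstoI)
    fix c assume "c < z \<bullet> y"
    then show "\<forall>\<^sub>F k in sequentially. c < x k \<bullet> y"
      using upper[of "z \<bullet> y - c" "- y"] by simp
  next
    fix c assume "z \<bullet> y < c"
    then show "\<forall>\<^sub>F k in sequentially. x k \<bullet> y < c"
      using upper[of "c - z \<bullet> y" y] by simp
  qed
  then show ?thesis using zZ by blast
qed

section \<open>Minty's theorem and the Yosida regularization\<close>

text \<open>
  Lifting a monotone graph by the pairing \<open>z \<bullet> u\<close> and taking the convex hull keeps it above the
  pairing. For a fixed graph point, monotonicity is an inequality affine in the other
  lifted point, so it extends to the hull; doing this in each of the two arguments gives it for a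
  pair of hull points, and on the diagonal it is the claim.
\<close>

lemma graph_hull_above_pairing:
  fixes G :: "('a::real_inner \<times> 'a) set"
  assumes mono: "\<And>z u z' u'. (z, u) \<in> G \<Longrightarrow> (z', u') \<in> G \<Longrightarrow> 0 \<le> (z - z') \<bullet> (u - u')"
    and mem: "(z, u, s) \<in> convex hull ((\<lambda>(z, u). (z, u, z \<bullet> u)) ` G)"
  shows "z \<bullet> u \<le> s"
proof -
  let ?L = "(\<lambda>(z, u). (z, u, z \<bullet> u)) ` G"
  have affine: "convex {(z, u, s). 0 \<le> s - z \<bullet> u' - z' \<bullet> u + c}" for z' u' :: 'a and c :: real
  proof -
    have "{(z, u, s). 0 \<le> s - z \<bullet> u' - z' \<bullet> u + c} = {v. - c \<le> (- u', - z', 1) \<bullet> v}"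
      by (auto simp: inner_commute)
    then show ?thesis by (simp only: convex_halfspace_ge)
  qed
  have half: "0 \<le> s - z \<bullet> u' - z' \<bullet> u + z' \<bullet> u'"
    if "(z, u, s) \<in> convex hull ?L" "(z', u') \<in> G" for z u s z' u'
  proof -
    have "convex hull ?L \<subseteq> {(z, u, s). 0 \<le> s - z \<bullet> u' - z' \<bullet> u + z' \<bullet> u'}"
    proof (rule hull_minimal)
      show "convex {(z, u, s). 0 \<le> s - z \<bullet> u' - z' \<bullet> u + z' \<bullet> u'}" by (rule affine)
      have "0 \<le> w \<bullet> v - w \<bullet> u' - z' \<bullet> v + z' \<bullet> u'" if "(w, v) \<in> G" for w v
        using mono[OF that \<open>(z', u') \<in> G\<close>] by (simp add: inner_diff_left inner_diff_right)
      then show "?L \<subseteq> {(z, u, s). 0 \<le> s - z \<bullet> u' - z' \<bullet> u + z' \<bullet> u'}" by auto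
    qed
    then show ?thesis using that(1) by blast
  qed
  have "convex hull ?L \<subseteq> {(z', u', s'). 0 \<le> s' - z' \<bullet> u - z \<bullet> u' + s}"
    using half[OF mem] by (intro hull_minimal affine) (auto simp: algebra_simps)
  then have "0 \<le> s - z \<bullet> u - z \<bullet> u + s" using mem by blast
  then show ?thesis by simp
qed

text \<open>
  The inequality for \<open>(z, u)\<close> says that \<open>y\<close> lies in the ball with centre \<open>c = (z - u) / 2\<close> and
  radius \<open>\<parallel>z + u\<parallel> / 2\<close>, so a common point of all these balls is wanted. Convex duality supplies it:
  minimize \<open>F (z, u, s) = s + \<parallel>c\<parallel>\<^sup>2\<close> over the convex hull of the lifted graph. On the hull
  \<open>F \<ge> z \<bullet> u + \<parallel>c\<parallel>\<^sup>2 = \<parallel>(z + u) / 2\<parallel>\<^sup>2 \<ge> 0\<close>. The centres along a minimizing sequence are Cauchy,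
  and the first-order condition at their limit \<open>y\<close>, tested towards a graph point, is the
  ball inequality for that point.
\<close>

lemma minty_core:
  fixes G :: "('a::{real_inner, complete_space} \<times> 'a) set"
  assumes mono: "\<And>z u z' u'. (z, u) \<in> G \<Longrightarrow> (z', u') \<in> G \<Longrightarrow> 0 \<le> (z - z') \<bullet> (u - u')"
  shows "\<exists>y. \<forall>(z, u)\<in>G. 0 \<le> (y - z) \<bullet> (- y - u)"
proof (cases "G = {}")
  case False
  define L where "L = (\<lambda>(z, u). (z, u, z \<bullet> u)) ` G"
  define K where "K = convex hull L"
  define c :: "'a \<times> 'a \<times> real \<Rightarrow> 'a" where "c v = (1 / 2) *\<^sub>R (fst v - fst (snd v))" for v
  define F where "F v = snd (snd v) + (norm (c v))\<^sup>2" for v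
  have F_nonneg: "0 \<le> F v" if "v \<in> K" for v
  proof -
    obtain z u s where v: "v = (z, u, s)" by (metis prod.exhaust)
    have "z \<bullet> u + (norm ((1 / 2) *\<^sub>R (z - u)))\<^sup>2 = (norm ((1 / 2) *\<^sub>R (z + u)))\<^sup>2"
      unfolding power2_norm_eq_inner by (simp add: inner_simps inner_commute field_simps)
    then have "0 \<le> z \<bullet> u + (norm ((1 / 2) *\<^sub>R (z - u)))\<^sup>2" by simp
    moreover have "z \<bullet> u \<le> s"
      using graph_hull_above_pairing[of G, OF mono] that by (auto simp: K_def L_def v)
    ultimately show ?thesis by (simp add: F_def c_def v)
  qed
  have F_conv: "F ((1 - t) *\<^sub>R v + t *\<^sub>R w) = (1 - t) * F v + t * F w - t * (1 - t) * (norm (c v - c w))\<^sup>2"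
    for v w t
  proof -
    have "c ((1 - t) *\<^sub>R v + t *\<^sub>R w) = (1 - t) *\<^sub>R c v + t *\<^sub>R c w"
      by (simp add: c_def scaleR_add_right scaleR_diff_right mult.commute)
    then have "F ((1 - t) *\<^sub>R v + t *\<^sub>R w) = (1 - t) * snd (snd v) + t * snd (snd w)
        + (norm ((1 - t) *\<^sub>R c v + t *\<^sub>R c w))\<^sup>2"
      by (simp add: F_def)
    then show ?thesis
      unfolding norm_sq_convex_combination F_def by (simp add: distrib_left)
  qed
  have K_conv: "(1 - t) *\<^sub>R v + t *\<^sub>R w \<in> K" if "v \<in> K" "w \<in> K" "0 \<le> t" "t \<le> 1" for v w t
    using that by (intro convexD[of K]) (auto simp: K_def)
  define m where "m = Inf (F ` K)"
  have ne: "F ` K \<noteq> {}" using False by (auto simp: K_def L_def)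
  have m_le: "m \<le> F v" if "v \<in> K" for v
    unfolding m_def using that F_nonneg by (intro cInf_lower bdd_belowI[of _ 0]) auto
  have m_nonneg: "0 \<le> m"
    unfolding m_def using ne F_nonneg by (intro cInf_greatest) auto
  have "\<exists>v\<in>K. F v < m + 1 / real (Suc n)" for n
    using cInf_lessD[OF ne, of "m + 1 / real (Suc n)"] by (auto simp: m_def)
  then obtain v where vK: "\<And>n. v n \<in> K" and v_lt: "\<And>n. F (v n) < m + 1 / real (Suc n)"
    by metis
  have Fv: "(\<lambda>n. F (v n)) \<longlonglongrightarrow> m"
  proof (rule tendsto_sandwich[where f = "\<lambda>_. m" and h = "\<lambda>n. m + 1 / real (Suc n)"])
    show "(\<lambda>n. m + 1 / real (Suc n)) \<longlonglongrightarrow> m" by real_asymp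
  qed (auto intro!: always_eventually m_le vK less_imp_le[OF v_lt] simp del: of_nat_Suc)
  have "Cauchy (\<lambda>n. c (v n))"
  proof (rule Cauchy_if_dist_sq_le)
    show "convergent (\<lambda>n. 0 :: real)" by (rule convergent_const)
    show "(\<lambda>n. 2 * (1 / real (Suc n))) \<longlonglongrightarrow> 0" by real_asymp
    fix n k :: nat
    have "m \<le> F ((1 - 1 / 2) *\<^sub>R v k + (1 / 2) *\<^sub>R v n)"
      by (intro m_le K_conv vK) auto
    then have "(norm (c (v k) - c (v n)))\<^sup>2 \<le> 2 * F (v k) + 2 * F (v n) - 4 * m"
      unfolding F_conv by simp
    then show "(norm (c (v k) - c (v n)))\<^sup>2
        \<le> \<bar>0 - 0\<bar> + 2 * (1 / real (Suc k)) + 2 * (1 / real (Suc n))"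
      using v_lt[of k] v_lt[of n] by linarith
  qed
  then obtain y where y: "(\<lambda>n. c (v n)) \<longlonglongrightarrow> y"
    by (meson Cauchy_convergent_iff convergent_def)
  have in_ball: "(norm (y - c w))\<^sup>2 \<le> F w" if w: "w \<in> K" for w
  proof -
    \<comment> \<open>Moving from the minimizing sequence a fraction \<open>t\<close> towards \<open>w\<close> cannot beat \<open>m\<close>.\<close>
    have approx: "m + (1 - t) * (norm (y - c w))\<^sup>2 \<le> F w" if t: "0 < t" "t < 1" for t
    proof -
      have "m \<le> (1 - t) * F (v n) + t * F w - t * (1 - t) * (norm (c (v n) - c w))\<^sup>2" for n
        using m_le[OF K_conv[OF vK[of n] w, of t]] t unfolding F_conv by simp
      moreover have "(\<lambda>n. (1 - t) * F (v n) + t * F w - t * (1 - t) * (norm (c (v n) - c w))\<^sup>2)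
          \<longlonglongrightarrow> (1 - t) * m + t * F w - t * (1 - t) * (norm (y - c w))\<^sup>2"
        by (intro tendsto_intros Fv y)
      ultimately have "m \<le> (1 - t) * m + t * F w - t * (1 - t) * (norm (y - c w))\<^sup>2"
        by (intro LIMSEQ_le_const) auto
      then have "t * (m + (1 - t) * (norm (y - c w))\<^sup>2) \<le> t * F w"
        by (simp add: algebra_simps)
      then show ?thesis using t by simp
    qed
    have "(\<lambda>n. m + (1 - 1 / real (n + 2)) * (norm (y - c w))\<^sup>2) \<longlonglongrightarrow> m + (norm (y - c w))\<^sup>2"
      by real_asymp
    then have "m + (norm (y - c w))\<^sup>2 \<le> F w"
      by (rule LIMSEQ_le_const2) (auto intro!: approx)
    then show ?thesis using m_nonneg by linarith
  qed
  have "0 \<le> (y - z) \<bullet> (- y - u)" if "(z, u) \<in> G" for z u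
  proof -
    have "(z, u, z \<bullet> u) \<in> K"
      using that by (auto simp: K_def L_def intro!: hull_inc image_eqI[where x = "(z, u)"])
    from in_ball[OF this]
    have "(norm (y - (1 / 2) *\<^sub>R (z - u)))\<^sup>2 \<le> z \<bullet> u + (norm ((1 / 2) *\<^sub>R (z - u)))\<^sup>2"
      by (simp add: F_def c_def)
    then show ?thesis
      unfolding power2_norm_eq_inner by (simp add: inner_simps inner_commute algebra_simps)
  qed
  then show ?thesis by blast
qed auto

text \<open>Otherwise \<open>(y, w)\<close> could be added to the graph.\<close>

lemma maximally_monotoneD:
  assumes max: "maximally_monotone T"
    and rel: "\<And>z u. u \<in> T z \<Longrightarrow> 0 \<le> (y - z) \<bullet> (w - u)"
  shows "w \<in> T y"
proof -
  define S where "S = T (y := insert w (T y))"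
  have mono: "0 \<le> (x - z) \<bullet> (u - v)" if "u \<in> T x" "v \<in> T z" for x z u v
    using max that by (auto simp: maximally_monotone_def monotone_operator_def)
  have rel': "0 \<le> (z - y) \<bullet> (u - w)" if "u \<in> T z" for z u
    using rel[OF that] by (simp add: inner_diff_left inner_diff_right algebra_simps)
  have "monotone_operator S"
    unfolding monotone_operator_def
  proof (intro allI ballI)
    fix x z u v assume "u \<in> S x" "v \<in> S z"
    then have "u \<in> T x \<or> x = y \<and> u = w" "v \<in> T z \<or> z = y \<and> v = w"
      by (auto simp: S_def split: if_splits)
    then show "0 \<le> (x - z) \<bullet> (u - v)"
      using mono rel rel' by (elim disjE) auto
  qed
  moreover have "\<forall>x. T x \<subseteq> S x" by (auto simp: S_def)
  ultimately have "S = T" using max by (auto simp: maximally_monotone_def)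
  then show ?thesis unfolding S_def by (metis fun_upd_same insertI1)
qed

context
  fixes T :: "'a::{real_inner, complete_space} \<Rightarrow> 'a set" and lam :: real
  assumes max: "maximally_monotone T" and lam: "0 < lam"
begin

lemma monotoneD:
  assumes "u \<in> T y" "v \<in> T z"
  shows "0 \<le> (y - z) \<bullet> (u - v)"
  using max assms by (auto simp: maximally_monotone_def monotone_operator_def)

text \<open>
  The operator \<open>z \<mapsto> lam T z - x\<close> is monotone; the point that the core lemma finds for it
  solves the resolvent equation at \<open>x\<close>, by maximality of \<open>T\<close>.
\<close>

lemma minty:
  "\<exists>y u. u \<in> T y \<and> x = y + lam *\<^sub>R u"
proof -
  define G where "G = {(z, lam *\<^sub>R u - x) | z u. u \<in> T z}"
  have "0 \<le> (z - z') \<bullet> (u - u')" if "(z, u) \<in> G" "(z', u') \<in> G" for z u z' u'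
    using that monotoneD lam by (auto simp: G_def simp flip: scaleR_diff_right)
  then obtain y where y: "\<forall>(z, u)\<in>G. 0 \<le> (y - z) \<bullet> (- y - u)"
    using minty_core[of G] by blast
  define w where "w = (1 / lam) *\<^sub>R (x - y)"
  have x: "x = y + lam *\<^sub>R w" using lam by (simp add: w_def)
  have "w \<in> T y"
  proof (rule maximally_monotoneD[OF max])
    fix z u assume "u \<in> T z"
    then have "(z, lam *\<^sub>R u - x) \<in> G" by (auto simp: G_def)
    with y have "0 \<le> (y - z) \<bullet> (- y - (lam *\<^sub>R u - x))" by blast
    also have "- y - (lam *\<^sub>R u - x) = lam *\<^sub>R (w - u)"
      by (simp add: x scaleR_diff_right)
    finally show "0 \<le> (y - z) \<bullet> (w - u)"
      using lam by (simp add: zero_le_mult_iff)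
  qed
  then show ?thesis using x by blast
qed

lemma resolvent_eqI:
  assumes u: "u \<in> T y"
  shows "resolvent lam T (y + lam *\<^sub>R u) = y"
  unfolding resolvent_def op_inverse_def
proof (rule the_equality)
  fix z assume "z \<in> {z. y + lam *\<^sub>R u \<in> {z + lam *\<^sub>R u |u. u \<in> T z}}"
  then obtain v where v: "v \<in> T z" and eq: "y + lam *\<^sub>R u = z + lam *\<^sub>R v" by auto
  have "y - z = lam *\<^sub>R (v - u)"
    using eq by (simp add: scaleR_diff_right algebra_simps)
  then have "v - u = (1 / lam) *\<^sub>R (y - z)" using lam by simp
  then have "u - v = - ((1 / lam) *\<^sub>R (y - z))" by (metis minus_diff_eq)
  then have "0 \<le> - ((1 / lam) * (norm (y - z))\<^sup>2)"
    using monotoneD[OF u v] by (simp add: power2_norm_eq_inner)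
  then have "(norm (y - z))\<^sup>2 \<le> 0"
    using lam by (simp add: field_simps)
  then show "z = y" by simp
qed (use u in blast)

lemma yosida_in_resolvent: "yosida lam T x \<in> T (x - lam *\<^sub>R yosida lam T x)"
proof -
  obtain y u where u: "u \<in> T y" and x: "x = y + lam *\<^sub>R u" using minty by blast
  have "resolvent lam T x = y" using resolvent_eqI[OF u] x by simp
  then have "yosida lam T x = u" using lam by (simp add: yosida_def x)
  then show ?thesis using u x by simp
qed

lemma yosida_cocoercive:
  "lam * (norm (yosida lam T x - yosida lam T y))\<^sup>2 \<le> (x - y) \<bullet> (yosida lam T x - yosida lam T y)"
  using monotoneD[OF yosida_in_resolvent[of x] yosida_in_resolvent[of y]]
  unfolding power2_norm_eq_inner by (simp add: inner_simps algebra_simps)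

lemma yosida_zero:
  assumes "0 \<in> T z"
  shows "yosida lam T z = 0"
  using resolvent_eqI[OF assms] by (simp add: yosida_def)

text \<open>
  Demiclosedness. The pair \<open>(x k - lam A k, A k)\<close> lies in the graph of \<open>T\<close>; testing it against a
  graph point \<open>(z, u)\<close> and letting \<open>A k\<close> vanish leaves a half-space \<open>{v. v \<bullet> u \<le> z \<bullet> u + e}\<close>
  that eventually contains \<open>x k\<close>, hence contains \<open>w\<close>.
\<close>

lemma zero_if_yosida_tendsto_zero:
  assumes bnd: "bounded (range x)"
    and A: "(\<lambda>k. yosida lam T (x k)) \<longlonglongrightarrow> 0"
    and w: "\<And>y c. \<forall>\<^sub>F k in sequentially. x k \<bullet> y \<le> c \<Longrightarrow> w \<bullet> y \<le> c"
  shows "0 \<in> T w"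
proof (rule maximally_monotoneD[OF max])
  fix z u assume u: "u \<in> T z"
  define A where "A k = yosida lam T (x k)" for k
  have A0: "A \<longlonglongrightarrow> 0" using A by (simp add: A_def[abs_def])
  define err where "err k = (x k - z) \<bullet> A k - lam * (A k \<bullet> (A k - u))" for k
  obtain B where B: "\<And>k. norm (x k) \<le> B"
    using bnd by (auto simp: bounded_iff)
  have "(\<lambda>k. (x k - z) \<bullet> A k) \<longlonglongrightarrow> 0"
  proof (rule Lim_null_comparison)
    have "\<bar>(x k - z) \<bullet> A k\<bar> \<le> (B + norm z) * norm (A k)" for k
      using Cauchy_Schwarz_ineq2[of "x k - z" "A k"] norm_triangle_ineq4[of "x k" z] B[of k]
        mult_right_mono[of "norm (x k - z)" "B + norm z" "norm (A k)"] by force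
    then show "\<forall>\<^sub>F k in sequentially. norm ((x k - z) \<bullet> A k) \<le> (B + norm z) * norm (A k)"
      by simp
    show "(\<lambda>k. (B + norm z) * norm (A k)) \<longlonglongrightarrow> 0"
      using A0 by (auto intro!: tendsto_eq_intros)
  qed
  then have err0: "err \<longlonglongrightarrow> 0"
  proof -
    have "(\<lambda>k. A k \<bullet> (A k - u)) \<longlonglongrightarrow> 0"
      using A0 by (auto intro!: tendsto_eq_intros)
    from tendsto_diff[OF \<open>(\<lambda>k. (x k - z) \<bullet> A k) \<longlonglongrightarrow> 0\<close> tendsto_mult_right_zero[OF this, of lam]]
    show ?thesis by (simp add: err_def[abs_def])
  qed
  have le: "x k \<bullet> u \<le> z \<bullet> u + err k" for k
  proof -
    have "0 \<le> (x k - lam *\<^sub>R A k - z) \<bullet> (A k - u)"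
      unfolding A_def by (rule monotoneD[OF yosida_in_resolvent u])
    then show ?thesis
      by (simp add: err_def inner_simps algebra_simps)
  qed
  have "w \<bullet> u \<le> z \<bullet> u"
  proof (rule field_le_epsilon)
    fix e :: real assume "0 < e"
    then have "\<forall>\<^sub>F k in sequentially. err k < e"
      using err0 by (intro order_tendstoD) auto
    then show "w \<bullet> u \<le> z \<bullet> u + e"
    proof (intro w, eventually_elim)
      case (elim k)
      then show ?case using le[of k] by simp
    qed
  qed
  then show "0 \<le> (w - z) \<bullet> (0 - u)"
    by (simp add: inner_diff_left)
qed

end

section \<open>Energy estimates for the contracting recursion\<close>

lemma powr_diff_le:
  fixes s t p :: real
  assumes "0 < s" "s < t" "1 \<le> p"
  shows "t powr p - s powr p \<le> p * t powr (p - 1) * (t - s)"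
proof -
  have "((\<lambda>x. x powr p) has_real_derivative p * x powr (p - 1)) (at x)" if "s \<le> x" for x
    using that assms by (intro has_real_derivative_powr) auto
  then obtain z where z: "s < z" "z < t" "t powr p - s powr p = (t - s) * (p * z powr (p - 1))"
    using MVT2[OF \<open>s < t\<close>, of "\<lambda>x. x powr p" "\<lambda>x. p * x powr (p - 1)"] by blast
  have "z powr (p - 1) \<le> t powr (p - 1)"
    using z assms by (intro powr_mono2) auto
  then have "(t - s) * (p * z powr (p - 1)) \<le> (t - s) * (p * t powr (p - 1))"
    using assms by (intro mult_left_mono) auto
  then show ?thesis using z by (simp add: algebra_simps)
qed

lemma inner_le_weighted_squares:
  fixes y z :: "'a::real_inner"
  assumes "0 < m"
  shows "\<bar>y \<bullet> z\<bar> \<le> m / 2 * (norm y)\<^sup>2 + 1 / (2 * m) * (norm z)\<^sup>2"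
proof -
  have "0 \<le> (m * norm y - norm z)\<^sup>2" by simp
  then have "2 * m * (norm y * norm z) \<le> m\<^sup>2 * (norm y)\<^sup>2 + (norm z)\<^sup>2"
    by (simp add: power2_eq_square algebra_simps)
  then have "norm y * norm z \<le> m / 2 * (norm y)\<^sup>2 + 1 / (2 * m) * (norm z)\<^sup>2"
    using assms by (simp add: field_simps power2_eq_square)
  then show ?thesis using Cauchy_Schwarz_ineq2[of y z] by linarith
qed

lemma half_norm_sq_diff_le:
  fixes y z :: "'a::real_inner"
  shows "(norm y)\<^sup>2 / 2 - (norm z)\<^sup>2 / 2 \<le> (y - z) \<bullet> y"
proof -
  have "0 \<le> (y - z) \<bullet> (y - z)" by simp
  then show ?thesis
    unfolding power2_norm_eq_inner by (simp add: inner_diff_left inner_diff_right inner_commute)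
qed

text \<open>
  The iteration with \<open>A k\<close> for the value of the Yosida regularization at \<open>x k\<close> and \<open>u k\<close> for
  \<open>v k - x k\<close>, after the powers of \<open>tau k = 1 / (a * k + 1)\<close> are simplified. The operator is
  represented by its monotonicity along consecutive iterates.
\<close>

locale contracting_recursion =
  fixes a mu p beta :: real
    and x A u g :: "nat \<Rightarrow> 'a::real_inner" and delta :: "nat \<Rightarrow> real"
  assumes a: "0 < a" and ap: "a * p \<le> 1 - mu" and p: "1 \<le> p"
    and mu: "0 < mu" and beta: "0 < beta"
    and delta: "summable delta" and g: "\<And>k. norm (g k) \<le> delta k"
    and u_0: "u 0 = 0" and u_Suc: "\<And>k. u (Suc k) = (a * real k) *\<^sub>R (x (Suc k) - x k)"
    and mono: "\<And>k. 0 \<le> (x (Suc k) - x k) \<bullet> (A (Suc k) - A k)"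
    and recursion: "\<And>k. (a * real k + 1) powr p *\<^sub>R A (Suc k)
      - (a * real k * (a * real k + 1) powr (p - 1)) *\<^sub>R A k
      + (u (Suc k) - u k) + (1 + beta) *\<^sub>R (x (Suc k) - x k) + g k = 0"
begin

definition r where "r k = (a * real k + 1) powr (p - 1)"
definition q where "q k = a * real k * r k"
definition d where "d k = x (Suc k) - x k"
definition Y where "Y k = u k + q k *\<^sub>R A k"
definition eps where "eps k = (a * real k + 1) * r k - q (Suc k)"

lemma delta_nonneg: "0 \<le> delta k"
  using g[of k] norm_ge_zero[of "g k"] by linarith

lemma a_less_1: "a < 1"
proof -
  have "a * 1 \<le> a * p" using a p by (intro mult_left_mono) auto
  then show ?thesis using ap mu by simp
qed

lemma s_ge_1: "1 \<le> a * real k + 1"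
  using a by simp

lemma r_ge_1: "1 \<le> r k"
  unfolding r_def using s_ge_1 p by (intro ge_one_powr_ge_zero) auto

lemma r_mono: "r k \<le> r (Suc k)"
  unfolding r_def using s_ge_1[of k] p a by (intro powr_mono2) (auto simp: algebra_simps)

lemma q_nonneg: "0 \<le> q k"
  unfolding q_def using r_ge_1[of k] a by simp

lemma powr_p: "(a * real k + 1) powr p = (a * real k + 1) * r k"
  unfolding r_def using s_ge_1[of k] by (simp add: powr_mult_base)

text \<open>
  The lower bound is where \<open>a * p \<le> 1 - mu\<close> enters: by convexity of the \<open>p\<close>-th power, passing
  from \<open>a * (k + 1) + 1\<close> to \<open>a * k + 1\<close> costs at most \<open>a * p * r (k + 1)\<close>, which leaves a multiple
  \<open>mu\<close> of the gap between \<open>(a * (k + 1) + 1) * r (k + 1)\<close> and \<open>q (k + 1)\<close>.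
\<close>

lemma eps_bounds: "mu * r (Suc k) \<le> eps k" "eps k \<le> r (Suc k)"
proof -
  have "(a * real (Suc k) + 1) powr p - (a * real k + 1) powr p
      \<le> p * (a * real (Suc k) + 1) powr (p - 1) * ((a * real (Suc k) + 1) - (a * real k + 1))"
    using add_nonneg_pos[of "a * real k" 1] a p by (intro powr_diff_le) auto
  also have "\<dots> = a * p * r (Suc k)"
    by (simp add: r_def algebra_simps)
  also have "\<dots> \<le> (1 - mu) * r (Suc k)"
    using ap r_ge_1[of "Suc k"] by (intro mult_right_mono) auto
  finally show "mu * r (Suc k) \<le> eps k"
    unfolding eps_def powr_p q_def by (simp add: algebra_simps)
  have "(a * real k + 1) * r k \<le> (a * real (Suc k) + 1) * r (Suc k)"
    using s_ge_1[of k] r_mono[of k] r_ge_1[of k] a by (intro mult_mono) (auto simp: algebra_simps)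
  then show "eps k \<le> r (Suc k)"
    unfolding eps_def q_def by (simp add: algebra_simps)
qed

lemma recursion':
  "((a * real k + 1) * r k) *\<^sub>R A (Suc k) - q k *\<^sub>R A k
    + (u (Suc k) - u k) + (1 + beta) *\<^sub>R d k + g k = 0"
  using recursion[of k] unfolding powr_p by (simp add: q_def r_def d_def)

lemma Y_step: "Y (Suc k) - Y k = - (eps k *\<^sub>R A (Suc k) + (1 + beta) *\<^sub>R d k + g k)"
  using recursion'[of k] by (simp add: Y_def eps_def algebra_simps add_eq_0_iff2)

lemma neg_g_inner_le: "- (g k \<bullet> y) \<le> delta k * norm y"
  using Cauchy_Schwarz_ineq2[of "g k" y] mult_right_mono[OF g[of k] norm_ge_zero[of y]] by linarith

text \<open>
  Paired with \<open>Y (k + 1) = a * k * d k + q (k + 1) * A (k + 1)\<close>, the right-hand side of the recursion is a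
  quadratic form in \<open>A (k + 1)\<close> and \<open>d k\<close>. Half of its negative part in \<open>A (k + 1)\<close> absorbs the
  mixed term at the price of a multiple of \<open>(k + 1) \<parallel>d k\<parallel>\<^sup>2\<close>, which the first energy has already shown
  to be summable.
\<close>

lemma Y_energy_step:
  "(norm (Y (Suc k)))\<^sup>2 / 2 + mu / 2 * (r (Suc k) * q (Suc k) * (norm (A (Suc k)))\<^sup>2)
    \<le> (norm (Y k))\<^sup>2 / 2 + (2 + beta)\<^sup>2 / (2 * mu) * (a * real (Suc k) * (norm (d k))\<^sup>2)
      + delta k * norm (Y (Suc k))"
proof -
  define c where "c = a * real k"
  \<comment> \<open>The weight for which the mixed term uses up exactly half of the dissipation
    \<open>mu * r (Suc k) * q (Suc k) * (norm (A (Suc k)))\<^sup>2\<close>.\<close>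
  define m where "m = mu * r (Suc k) / (2 + beta)"
  define kap where "kap = eps k * c + (1 + beta) * q (Suc k)"
  have c: "0 \<le> c" "c \<le> a * real (Suc k)" using a by (simp_all add: c_def)
  have m: "0 < m" using mu beta r_ge_1[of "Suc k"] by (simp add: m_def)
  have eps0: "0 \<le> eps k"
    using eps_bounds(1)[of k] mu r_ge_1[of "Suc k"] by (smt (verit) mult_nonneg_nonneg)
  have "eps k * c \<le> r (Suc k) * (a * real (Suc k))"
    using c eps0 eps_bounds(2)[of k] r_ge_1[of "Suc k"] by (intro mult_mono) auto
  also have "\<dots> = q (Suc k)" by (simp add: q_def)
  finally have eps_c: "eps k * c \<le> q (Suc k)" .
  have "0 \<le> kap"
    using c eps0 q_nonneg[of "Suc k"] beta by (simp add: kap_def)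
  moreover have "kap \<le> (2 + beta) * q (Suc k)"
    using eps_c by (simp add: kap_def distrib_right)
  ultimately have kap: "0 \<le> kap" "kap \<le> (2 + beta) * q (Suc k)" by blast+
  have "(norm (Y (Suc k)))\<^sup>2 / 2 - (norm (Y k))\<^sup>2 / 2 \<le> (Y (Suc k) - Y k) \<bullet> Y (Suc k)"
    by (rule half_norm_sq_diff_le)
  also have "\<dots> = - (eps k * (A (Suc k) \<bullet> Y (Suc k))) - (1 + beta) * (d k \<bullet> Y (Suc k)) - g k \<bullet> Y (Suc k)"
    unfolding Y_step by (simp add: inner_diff_left inner_add_left algebra_simps)
  also have "\<dots> = - (eps k * q (Suc k) * (norm (A (Suc k)))\<^sup>2) - kap * (A (Suc k) \<bullet> d k)
      - (1 + beta) * c * (norm (d k))\<^sup>2 - g k \<bullet> Y (Suc k)"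
  proof -
    have "Y (Suc k) = c *\<^sub>R d k + q (Suc k) *\<^sub>R A (Suc k)"
      by (simp add: Y_def u_Suc c_def d_def)
    then have "A (Suc k) \<bullet> Y (Suc k) = c * (A (Suc k) \<bullet> d k) + q (Suc k) * (norm (A (Suc k)))\<^sup>2"
      "d k \<bullet> Y (Suc k) = c * (norm (d k))\<^sup>2 + q (Suc k) * (A (Suc k) \<bullet> d k)"
      by (simp_all add: inner_add_right power2_norm_eq_inner inner_commute)
    then show ?thesis by (simp add: kap_def algebra_simps)
  qed
  finally have "(norm (Y (Suc k)))\<^sup>2 / 2 - (norm (Y k))\<^sup>2 / 2 \<le> \<dots>" .
  moreover have "mu * r (Suc k) * q (Suc k) * (norm (A (Suc k)))\<^sup>2 \<le> eps k * q (Suc k) * (norm (A (Suc k)))\<^sup>2"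
    using eps_bounds(1)[of k] q_nonneg[of "Suc k"] by (intro mult_right_mono) auto
  moreover have "- (kap * (A (Suc k) \<bullet> d k))
      \<le> mu / 2 * (r (Suc k) * q (Suc k) * (norm (A (Suc k)))\<^sup>2)
        + (2 + beta)\<^sup>2 / (2 * mu) * (a * real (Suc k) * (norm (d k))\<^sup>2)"
  proof -
    have "- (kap * (A (Suc k) \<bullet> d k)) = kap * - (A (Suc k) \<bullet> d k)" by simp
    also have "\<dots> \<le> kap * \<bar>A (Suc k) \<bullet> d k\<bar>"
      using kap by (intro mult_left_mono) auto
    also have "\<dots> \<le> (2 + beta) * q (Suc k) * (m / 2 * (norm (A (Suc k)))\<^sup>2 + 1 / (2 * m) * (norm (d k))\<^sup>2)"
      using kap inner_le_weighted_squares[OF m, of "A (Suc k)" "d k"] by (intro mult_mono) auto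
    also have "\<dots> = mu / 2 * (r (Suc k) * q (Suc k) * (norm (A (Suc k)))\<^sup>2)
        + (2 + beta)\<^sup>2 / (2 * mu) * (a * real (Suc k) * (norm (d k))\<^sup>2)"
    proof -
      have "(2 + beta) * m = mu * r (Suc k)"
        using beta by (simp add: m_def)
      then have "((2 + beta) * m) * (q (Suc k) / 2) = (mu * r (Suc k)) * (q (Suc k) / 2)"
        by (simp only:)
      then have "(2 + beta) * q (Suc k) * (m / 2) = mu / 2 * (r (Suc k) * q (Suc k))"
        by (simp only: times_divide_eq_left times_divide_eq_right mult_ac)
      moreover have "(2 + beta) * q (Suc k) * (1 / (2 * m)) = (2 + beta)\<^sup>2 / (2 * mu) * (a * real (Suc k))"
        using beta mu r_ge_1[of "Suc k"] by (simp add: m_def q_def power2_eq_square)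
      ultimately show ?thesis by (metis distrib_left mult.assoc)
    qed
    finally show ?thesis .
  qed
  moreover have "0 \<le> (1 + beta) * c * (norm (d k))\<^sup>2" using beta c by simp
  ultimately show ?thesis
    using neg_g_inner_le[of k "Y (Suc k)"] unfolding mult.assoc by linarith
qed

text \<open>
  Here \<open>u (k + 1)\<close> is a nonnegative multiple of \<open>d k\<close>, so monotonicity disposes of the part of the
  recursion with the increment of \<open>A\<close>, and the remaining mixed term is bounded by quantities that
  the other two energies have shown to be summable.
\<close>

lemma u_energy_step:
  "(norm (u (Suc k)))\<^sup>2 / 2
    \<le> (norm (u k))\<^sup>2 / 2 + (r (Suc k) * q (Suc k) * (norm (A (Suc k)))\<^sup>2 + a * real (Suc k) * (norm (d k))\<^sup>2)
      + delta k * norm (u (Suc k))"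
proof -
  define c where "c = a * real k"
  have c: "0 \<le> c" "c \<le> a * real (Suc k)" using a by (simp_all add: c_def)
  have u: "u (Suc k) = c *\<^sub>R d k" by (simp add: u_Suc c_def d_def)
  have "(((c + 1) * r k) *\<^sub>R A (Suc k) - (c * r k) *\<^sub>R A k
      + (u (Suc k) - u k) + (1 + beta) *\<^sub>R d k + g k) \<bullet> u (Suc k) = 0"
    using recursion'[of k] by (simp add: c_def q_def)
  then have "(((c + 1) * r k) *\<^sub>R A (Suc k) - (c * r k) *\<^sub>R A k) \<bullet> u (Suc k)
      + (u (Suc k) - u k) \<bullet> u (Suc k) + (1 + beta) * (d k \<bullet> u (Suc k)) + g k \<bullet> u (Suc k) = 0"
    by (simp add: inner_add_left)
  moreover have "(((c + 1) * r k) *\<^sub>R A (Suc k) - (c * r k) *\<^sub>R A k) \<bullet> u (Suc k)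
      = c * r k * (A (Suc k) \<bullet> d k) + c * c * r k * (d k \<bullet> (A (Suc k) - A k))"
    unfolding u by (simp add: inner_simps inner_commute algebra_simps)
  moreover have "0 \<le> c * c * r k * (d k \<bullet> (A (Suc k) - A k))"
    using r_ge_1[of k] c mono[of k] by (intro mult_nonneg_nonneg) (auto simp: d_def)
  moreover have "0 \<le> (1 + beta) * (d k \<bullet> u (Suc k))"
    using beta c by (simp add: u)
  moreover have "(norm (u (Suc k)))\<^sup>2 / 2 - (norm (u k))\<^sup>2 / 2 \<le> (u (Suc k) - u k) \<bullet> u (Suc k)"
    by (rule half_norm_sq_diff_le)
  moreover have "- (c * r k * (A (Suc k) \<bullet> d k))
      \<le> r (Suc k) * q (Suc k) * (norm (A (Suc k)))\<^sup>2 + a * real (Suc k) * (norm (d k))\<^sup>2"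
  proof -
    have r': "0 < r (Suc k)" using r_ge_1[of "Suc k"] by simp
    have "- (c * r k * (A (Suc k) \<bullet> d k)) = c * r k * - (A (Suc k) \<bullet> d k)" by simp
    also have "\<dots> \<le> c * r k * \<bar>A (Suc k) \<bullet> d k\<bar>"
      using c r_ge_1[of k] by (intro mult_left_mono) auto
    also have "\<dots> \<le> a * real (Suc k) * r (Suc k) *
        (r (Suc k) / 2 * (norm (A (Suc k)))\<^sup>2 + 1 / (2 * r (Suc k)) * (norm (d k))\<^sup>2)"
      using c r_mono[of k] r_ge_1[of k] inner_le_weighted_squares[OF r', of "A (Suc k)" "d k"] a
      by (intro mult_mono) auto
    also have "\<dots> = (r (Suc k) * q (Suc k) * (norm (A (Suc k)))\<^sup>2 + a * real (Suc k) * (norm (d k))\<^sup>2) / 2"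
      using r' by (simp add: q_def field_simps)
    also have "\<dots> \<le> r (Suc k) * q (Suc k) * (norm (A (Suc k)))\<^sup>2 + a * real (Suc k) * (norm (d k))\<^sup>2"
      using r' q_nonneg[of "Suc k"] a by simp
    finally show ?thesis .
  qed
  ultimately show ?thesis
    using neg_g_inner_le[of k "u (Suc k)"] by linarith
qed

context
  fixes z :: 'a and lam :: real
  assumes lam: "0 < lam" and z: "\<And>k. lam * (norm (A k))\<^sup>2 \<le> (x k - z) \<bullet> A k"
begin

definition E where
  "E k = (norm (x k - z + u k))\<^sup>2 / 2 + beta / 2 * (norm (x k - z))\<^sup>2 + q k * ((x k - z) \<bullet> A k)"

lemma pairing_nonneg: "0 \<le> (x k - z) \<bullet> A k"
  using z[of k] lam by (smt (verit) mult_nonneg_nonneg zero_le_power2)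

text \<open>
  Pairing the recursion with \<open>w' = v (k + 1) - z\<close>. The operator part turns into the increment of
  \<open>q k * ((x k - z) \<bullet> A k)\<close>, plus the dissipation with factor \<open>eps k\<close>, plus a multiple of
  \<open>d k \<bullet> (A (k + 1) - A k)\<close>, nonnegative by monotonicity. The \<open>beta\<close> term gives the
  dissipation of the velocity \<open>d k\<close>.
\<close>

lemma energy_step:
  "E (Suc k) + (eps k * ((x (Suc k) - z) \<bullet> A (Suc k)) + beta * (a * real k + 1 / 2) * (norm (d k))\<^sup>2)
    \<le> E k + delta k * norm (x (Suc k) - z + u (Suc k))"
proof -
  define c where "c = a * real k"
  define e where "e = x k - z"
  define w' where "w' = x (Suc k) - z + u (Suc k)"
  define w where "w = x k - z + u k"
  have c: "0 \<le> c" using a by (simp add: c_def)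
  have e': "x (Suc k) - z = e + d k" by (simp add: e_def d_def)
  have w': "w' = e + (1 + c) *\<^sub>R d k"
    by (simp add: w'_def u_Suc c_def e_def d_def algebra_simps)
  have "((c + 1) * r k) *\<^sub>R A (Suc k) - (c * r k) *\<^sub>R A k + (w' - w) + beta *\<^sub>R d k + g k = 0"
    using recursion'[of k] by (simp add: c_def q_def w'_def w_def d_def algebra_simps)
  then have "(((c + 1) * r k) *\<^sub>R A (Suc k) - (c * r k) *\<^sub>R A k + (w' - w) + beta *\<^sub>R d k + g k) \<bullet> w' = 0"
    by simp
  then have "(((c + 1) * r k) *\<^sub>R A (Suc k) - (c * r k) *\<^sub>R A k) \<bullet> w'
      + (w' - w) \<bullet> w' + beta * (d k \<bullet> w') + g k \<bullet> w' = 0"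
    by (simp add: inner_add_left)
  moreover have "q (Suc k) * ((x (Suc k) - z) \<bullet> A (Suc k)) + eps k * ((x (Suc k) - z) \<bullet> A (Suc k)) - q k * (e \<bullet> A k)
      \<le> (((c + 1) * r k) *\<^sub>R A (Suc k) - (c * r k) *\<^sub>R A k) \<bullet> w'"
  proof -
    have "(((c + 1) * r k) *\<^sub>R A (Suc k) - (c * r k) *\<^sub>R A k) \<bullet> w'
        = (c + 1) * r k * ((x (Suc k) - z) \<bullet> A (Suc k)) - c * r k * (e \<bullet> A k)
          + r k * c * (c + 1) * (d k \<bullet> (A (Suc k) - A k))"
      unfolding w' e' by (simp add: inner_simps inner_commute algebra_simps)
    moreover have "0 \<le> r k * c * (c + 1) * (d k \<bullet> (A (Suc k) - A k))"
      using r_ge_1[of k] c mono[of k] by (intro mult_nonneg_nonneg) (auto simp: d_def)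
    moreover have "(c + 1) * r k * ((x (Suc k) - z) \<bullet> A (Suc k))
        = q (Suc k) * ((x (Suc k) - z) \<bullet> A (Suc k)) + eps k * ((x (Suc k) - z) \<bullet> A (Suc k))"
      by (simp add: eps_def c_def left_diff_distrib)
    moreover have "c * r k * (e \<bullet> A k) = q k * (e \<bullet> A k)"
      by (simp add: c_def q_def)
    ultimately show ?thesis by linarith
  qed
  moreover have "beta * (d k \<bullet> w')
      = beta / 2 * (norm (x (Suc k) - z))\<^sup>2 - beta / 2 * (norm e)\<^sup>2 + beta * (c + 1 / 2) * (norm (d k))\<^sup>2"
  proof -
    have "d k \<bullet> w' = (norm (x (Suc k) - z))\<^sup>2 / 2 - (norm e)\<^sup>2 / 2 + (c + 1 / 2) * (norm (d k))\<^sup>2"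
      unfolding w' e' power2_norm_eq_inner by (simp add: inner_simps inner_commute field_simps)
    then show ?thesis by (simp add: distrib_left right_diff_distrib)
  qed
  moreover have "(norm w')\<^sup>2 / 2 - (norm w)\<^sup>2 / 2 \<le> (w' - w) \<bullet> w'"
    by (rule half_norm_sq_diff_le)
  moreover have "- (g k \<bullet> w') \<le> delta k * norm w'"
    by (rule neg_g_inner_le)
  moreover have "E k = (norm w)\<^sup>2 / 2 + beta / 2 * (norm e)\<^sup>2 + q k * (e \<bullet> A k)"
    "E (Suc k) = (norm w')\<^sup>2 / 2 + beta / 2 * (norm (x (Suc k) - z))\<^sup>2
      + q (Suc k) * ((x (Suc k) - z) \<bullet> A (Suc k))"
    by (simp_all add: E_def w_def w'_def e_def)
  ultimately show ?thesis
    unfolding w'_def[symmetric] c_def[symmetric] by linarith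
qed

lemma energy_convergent: "convergent E"
  and summable_velocity: "summable (\<lambda>k. a * real (Suc k) * (norm (d k))\<^sup>2)"
  and summable_residual: "summable (\<lambda>k. (norm (A (Suc k)))\<^sup>2)"
proof -
  define b where "b k = eps k * ((x (Suc k) - z) \<bullet> A (Suc k)) + beta * (a * real k + 1 / 2) * (norm (d k))\<^sup>2" for k
  have eps_mu: "mu \<le> eps k" for k
    using eps_bounds(1)[of k] mult_left_mono[OF r_ge_1[of "Suc k"], of mu] mu by linarith
  have 1: "0 \<le> eps k * ((x (Suc k) - z) \<bullet> A (Suc k))" for k
    using eps_mu[of k] mu pairing_nonneg by (intro mult_nonneg_nonneg) auto
  have 2: "0 \<le> beta * (a * real k + 1 / 2) * (norm (d k))\<^sup>2" for k
    using beta a by simp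
  have w: "(norm (x k - z + u k))\<^sup>2 \<le> 2 * E k" for k
    using beta q_nonneg[of k] pairing_nonneg[of k] by (simp add: E_def)
  have b0: "0 \<le> b k" for k using 1[of k] 2[of k] by (simp add: b_def)
  have step: "E (Suc k) + b k \<le> E k + 0 + delta k * norm (x (Suc k) - z + u (Suc k))" for k
    using energy_step[of k] by (simp add: b_def)
  note res = convergent_if_almost_decreasing_sqrt[where w = "\<lambda>k. norm (x k - z + u k)" and c = "\<lambda>_. 0",
      OF norm_ge_zero w b0 order_refl delta_nonneg summable_zero delta step]
  show "convergent E" by (rule res(1))
  have sb: "summable b" by (rule res(2))
  show "summable (\<lambda>k. a * real (Suc k) * (norm (d k))\<^sup>2)"
  proof (rule summable_comparison_test'[OF summable_mult[OF sb, of "2 / beta"], of 0])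
    fix k :: nat
    have "a * real (Suc k) * (norm (d k))\<^sup>2 \<le> 2 * (a * real k + 1 / 2) * (norm (d k))\<^sup>2"
    proof (rule mult_right_mono)
      have "0 \<le> a * real k" using a by simp
      then show "a * real (Suc k) \<le> 2 * (a * real k + 1 / 2)"
        using a_less_1 by (simp add: distrib_left)
    qed simp
    also have "\<dots> = 2 / beta * (beta * (a * real k + 1 / 2) * (norm (d k))\<^sup>2)"
      using beta by simp
    also have "\<dots> \<le> 2 / beta * b k"
      using 1[of k] beta by (intro mult_left_mono) (auto simp: b_def)
    finally show "norm (a * real (Suc k) * (norm (d k))\<^sup>2) \<le> 2 / beta * b k"
      using a by simp
  qed
  show "summable (\<lambda>k. (norm (A (Suc k)))\<^sup>2)"
  proof (rule summable_comparison_test'[OF summable_mult[OF sb, of "1 / (mu * lam)"], of 0])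
    fix k :: nat
    have "mu * (lam * (norm (A (Suc k)))\<^sup>2) \<le> eps k * ((x (Suc k) - z) \<bullet> A (Suc k))"
      using eps_mu[of k] mu lam by (intro mult_mono z) auto
    also have "\<dots> \<le> b k" using 2[of k] by (simp add: b_def)
    finally show "norm ((norm (A (Suc k)))\<^sup>2) \<le> 1 / (mu * lam) * b k"
      using mu lam by (simp add: field_simps)
  qed
qed

lemma residual_tendsto_0: "A \<longlonglongrightarrow> 0"
proof -
  have "(\<lambda>k. (norm (A (Suc k)))\<^sup>2) \<longlonglongrightarrow> 0"
    by (rule summable_LIMSEQ_zero[OF summable_residual])
  then have "(\<lambda>k. sqrt ((norm (A (Suc k)))\<^sup>2)) \<longlonglongrightarrow> sqrt 0"
    by (rule tendsto_real_sqrt)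
  then have "(\<lambda>k. A (Suc k)) \<longlonglongrightarrow> 0"
    by (simp add: tendsto_norm_zero_iff)
  then show ?thesis by (rule LIMSEQ_imp_Suc)
qed

lemma bounded_iterates: "bounded (range x)"
proof -
  obtain B where B: "\<And>k. norm (E k) \<le> B"
    using convergent_imp_Bseq[OF energy_convergent] by (auto simp: Bseq_def)
  have "norm (x k) \<le> 2 * B / beta + 1 + norm z" for k
  proof -
    have "beta / 2 * (norm (x k - z))\<^sup>2 \<le> B"
      using B[of k] mult_nonneg_nonneg[OF q_nonneg[of k] pairing_nonneg[of k]]
        zero_le_power2[of "norm (x k - z + u k)"] unfolding E_def real_norm_def by linarith
    then have "(norm (x k - z))\<^sup>2 \<le> 2 * B / beta"
      using beta by (simp add: field_simps)
    moreover have "norm (x k - z) \<le> (norm (x k - z))\<^sup>2 + 1"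
    proof -
      have "0 \<le> (norm (x k - z) - 1)\<^sup>2" by simp
      then have "2 * norm (x k - z) \<le> (norm (x k - z))\<^sup>2 + 1" by (simp add: power2_diff)
      then show ?thesis using norm_ge_zero[of "x k - z"] by linarith
    qed
    ultimately show ?thesis using norm_triangle_sub[of "x k" z] by linarith
  qed
  then show ?thesis by (auto simp: bounded_iff)
qed

lemma Y_convergent: "convergent (\<lambda>k. (norm (Y k))\<^sup>2 / 2)"
  and summable_weighted_residual: "summable (\<lambda>k. r (Suc k) * q (Suc k) * (norm (A (Suc k)))\<^sup>2)"
proof -
  have b: "0 \<le> mu / 2 * (r (Suc k) * q (Suc k) * (norm (A (Suc k)))\<^sup>2)" for k
    using mu r_ge_1[of "Suc k"] q_nonneg[of "Suc k"] by (intro mult_nonneg_nonneg) auto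
  have c: "0 \<le> (2 + beta)\<^sup>2 / (2 * mu) * (a * real (Suc k) * (norm (d k))\<^sup>2)" for k
    using mu a by simp
  have w: "(norm (Y k))\<^sup>2 \<le> 2 * ((norm (Y k))\<^sup>2 / 2)" for k by simp
  note res = convergent_if_almost_decreasing_sqrt[where E = "\<lambda>k. (norm (Y k))\<^sup>2 / 2",
      OF norm_ge_zero w b c delta_nonneg summable_mult[OF summable_velocity] delta Y_energy_step]
  show "convergent (\<lambda>k. (norm (Y k))\<^sup>2 / 2)" by (rule res(1))
  show "summable (\<lambda>k. r (Suc k) * q (Suc k) * (norm (A (Suc k)))\<^sup>2)"
    using res(2) mu by (simp add: summable_cmult_iff)
qed

lemma u_convergent: "convergent (\<lambda>k. (norm (u k))\<^sup>2 / 2)"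
proof -
  have c: "0 \<le> r (Suc k) * q (Suc k) * (norm (A (Suc k)))\<^sup>2 + a * real (Suc k) * (norm (d k))\<^sup>2" for k
    using a r_ge_1[of "Suc k"] q_nonneg[of "Suc k"] by simp
  have w: "(norm (u k))\<^sup>2 \<le> 2 * ((norm (u k))\<^sup>2 / 2)" for k by simp
  have "(norm (u (Suc k)))\<^sup>2 / 2 + 0 \<le> (norm (u k))\<^sup>2 / 2
      + (r (Suc k) * q (Suc k) * (norm (A (Suc k)))\<^sup>2 + a * real (Suc k) * (norm (d k))\<^sup>2)
      + delta k * norm (u (Suc k))" for k
    using u_energy_step[of k] by simp
  from convergent_if_almost_decreasing_sqrt(1)[where E = "\<lambda>k. (norm (u k))\<^sup>2 / 2" and b = "\<lambda>_. 0",
      OF norm_ge_zero w order_refl c delta_nonneg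
        summable_add[OF summable_weighted_residual summable_velocity] delta this]
  show ?thesis .
qed

lemma norm_sq_u_over_index:
  "(norm (u (Suc k)))\<^sup>2 / real (Suc k) \<le> a * (a * real (Suc k) * (norm (d k))\<^sup>2)"
proof -
  have "(norm (u (Suc k)))\<^sup>2 = (a * real k)\<^sup>2 * (norm (d k))\<^sup>2"
    by (simp add: u_Suc d_def power_mult_distrib)
  also have "\<dots> \<le> (a * real (Suc k))\<^sup>2 * (norm (d k))\<^sup>2"
    using a by (intro mult_right_mono power_mono) auto
  also have "\<dots> = a * (a * real (Suc k) * (norm (d k))\<^sup>2) * real (Suc k)"
    by (simp add: power2_eq_square)
  finally show ?thesis by (simp only: pos_divide_le_eq of_nat_0_less_iff zero_less_Suc)
qed

lemma u_tendsto_0: "u \<longlonglongrightarrow> 0"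
proof (rule tendsto_0_if_half_norm_sq[OF u_convergent])
  show "summable (\<lambda>k. (norm (u (Suc k)))\<^sup>2 / real (Suc k))"
    by (rule summable_comparison_test'[OF summable_mult[OF summable_velocity, of a], of 0])
      (use norm_sq_u_over_index in simp)
qed

lemma Y_tendsto_0: "Y \<longlonglongrightarrow> 0"
proof (rule tendsto_0_if_half_norm_sq[OF Y_convergent])
  define b where "b k = 2 * (a * (a * real (Suc k) * (norm (d k))\<^sup>2))
    + 2 * (a * (r (Suc k) * q (Suc k) * (norm (A (Suc k)))\<^sup>2))" for k
  have sb: "summable b"
    unfolding b_def by (intro summable_add summable_mult summable_velocity summable_weighted_residual)
  have "(norm (Y (Suc k)))\<^sup>2 / real (Suc k) \<le> b k" for k
  proof -
    have "(norm (Y (Suc k)))\<^sup>2 \<le> 2 * (norm (u (Suc k)))\<^sup>2 + 2 * (norm (q (Suc k) *\<^sub>R A (Suc k)))\<^sup>2"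
    proof -
      have "0 \<le> (norm (u (Suc k) - q (Suc k) *\<^sub>R A (Suc k)))\<^sup>2" by simp
      then show ?thesis
        unfolding Y_def power2_norm_eq_inner
        by (simp only: inner_add_left inner_add_right inner_diff_left inner_diff_right inner_commute)
    qed
    then have "(norm (Y (Suc k)))\<^sup>2 / real (Suc k) \<le> (2 * (norm (u (Suc k)))\<^sup>2
        + 2 * (norm (q (Suc k) *\<^sub>R A (Suc k)))\<^sup>2) / real (Suc k)"
      by (intro divide_right_mono) auto
    also have "\<dots> = 2 * ((norm (u (Suc k)))\<^sup>2 / real (Suc k))
        + 2 * (a * (r (Suc k) * q (Suc k) * (norm (A (Suc k)))\<^sup>2))"
    proof -
      have "(norm (q (Suc k) *\<^sub>R A (Suc k)))\<^sup>2 = (q (Suc k))\<^sup>2 * (norm (A (Suc k)))\<^sup>2"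
        by (simp add: power_mult_distrib)
      also have "\<dots> = a * (r (Suc k) * q (Suc k) * (norm (A (Suc k)))\<^sup>2) * real (Suc k)"
        by (simp add: q_def power2_eq_square)
      finally show ?thesis
        by (simp add: add_divide_distrib del: of_nat_Suc)
    qed
    finally show ?thesis
      using norm_sq_u_over_index[of k] unfolding b_def by linarith
  qed
  then show "summable (\<lambda>k. (norm (Y (Suc k)))\<^sup>2 / real (Suc k))"
    by (intro summable_comparison_test'[OF sb, of 0]) simp
qed

text \<open>
  Expanding \<open>E\<close> around \<open>x k - z\<close>, its parts other than the squared distance are
  \<open>Y k \<bullet> (x k - z)\<close> and \<open>(norm (u k))\<^sup>2 / 2\<close>, which converge.
\<close>

lemma distance_convergent: "convergent (\<lambda>k. (norm (x k - z))\<^sup>2)"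
proof -
  obtain B where B: "\<And>k. norm (x k) \<le> B"
    using bounded_iterates by (auto simp: bounded_iff)
  have YE: "(\<lambda>k. Y k \<bullet> (x k - z)) \<longlonglongrightarrow> 0"
  proof (rule Lim_null_comparison)
    have "\<bar>Y k \<bullet> (x k - z)\<bar> \<le> norm (Y k) * (B + norm z)" for k
      using Cauchy_Schwarz_ineq2[of "Y k" "x k - z"] norm_triangle_ineq4[of "x k" z] B[of k]
        mult_left_mono[of "norm (x k - z)" "B + norm z" "norm (Y k)"] by force
    then show "\<forall>\<^sub>F k in sequentially. norm (Y k \<bullet> (x k - z)) \<le> norm (Y k) * (B + norm z)"
      by simp
    show "(\<lambda>k. norm (Y k) * (B + norm z)) \<longlonglongrightarrow> 0"
      using Y_tendsto_0 by (auto intro!: tendsto_eq_intros)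
  qed
  have eq: "(norm (x k - z))\<^sup>2 = (E k - Y k \<bullet> (x k - z) - (norm (u k))\<^sup>2 / 2) * (2 / (1 + beta))" for k
  proof -
    have "E k - Y k \<bullet> (x k - z) - (norm (u k))\<^sup>2 / 2 = (1 + beta) / 2 * (norm (x k - z))\<^sup>2"
    proof -
      have "(norm (x k - z + u k))\<^sup>2 = (norm (x k - z))\<^sup>2 + 2 * (u k \<bullet> (x k - z)) + (norm (u k))\<^sup>2"
        unfolding power2_norm_eq_inner
        by (simp only: inner_add_left inner_add_right inner_commute[of "x k - z" "u k"])
      moreover have "Y k \<bullet> (x k - z) = u k \<bullet> (x k - z) + q k * ((x k - z) \<bullet> A k)"
        unfolding Y_def by (simp only: inner_add_left inner_scaleR_left inner_commute[of "A k"])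
      ultimately show ?thesis
        unfolding E_def by (simp add: distrib_right add_divide_distrib)
    qed
    then show ?thesis using beta by simp
  qed
  show ?thesis
    unfolding eq using YE
    by (intro convergent_mult convergent_diff energy_convergent u_convergent convergent_const)
      (auto simp: convergent_def)
qed

end

end

section \<open>Weak convergence of the proximal point algorithm\<close>

lemma ppa_v_Suc:
  "ppa_v a tau_m1 x_m1 x (Suc k) = x (Suc k) + (a * real k) *\<^sub>R (x (Suc k) - x k)"
  if "0 < a"
proof -
  have s: "a * real k + 1 \<noteq> 0" using that by (smt (verit) mult_nonneg_nonneg of_nat_0_le_iff)
  then have "(1 - 1 / (a * real k + 1)) / (1 / (a * real k + 1)) = a * real k"
    by (simp add: field_simps)
  then show ?thesis
    by (simp add: ppa_v_def ppa_tau_def algebra_simps)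
qed

lemma ppa_v_0: "tau_m1 \<noteq> 0 \<Longrightarrow> ppa_v a tau_m1 (x 0) x 0 = x 0"
  by (simp add: ppa_v_def flip: scaleR_diff_left add: diff_divide_distrib)

lemma sublinear_ppa_imp_contracting_recursion:
  fixes T :: "'a::{real_inner, complete_space} \<Rightarrow> 'a set"
  assumes max: "maximally_monotone T" and mu: "0 < mu" and beta: "0 < beta"
    and ppa: "sublinear_contracting_ppa T mu p a tau_m1 lam beta delta g x_m1 x"
  shows "contracting_recursion a mu p beta x (\<lambda>k. yosida lam T (x k))
    (\<lambda>k. ppa_v a tau_m1 x_m1 x k - x k) g delta"
proof -
  have a: "0 < a" and ap: "a \<le> (1 - mu) / p" and p: "1 \<le> p" and lam: "0 < lam"
    and tau: "0 < tau_m1" and x_m1: "x_m1 = x 0"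
    and delta: "summable delta" "\<And>k. norm (g k) \<le> delta k"
    and step: "\<And>k. 0 = (1 / ppa_tau a k powr p) *\<^sub>R yosida lam T (x (Suc k))
            - ((1 - ppa_tau a k) / ppa_tau a k powr p) *\<^sub>R yosida lam T (x k)
            + (ppa_v a tau_m1 x_m1 x (Suc k) - ppa_v a tau_m1 x_m1 x k)
            + beta *\<^sub>R (x (Suc k) - x k) + g k"
    using ppa unfolding sublinear_contracting_ppa_def by auto
  show ?thesis
  proof
    show "a * p \<le> 1 - mu" using ap p by (simp add: field_simps)
    show "ppa_v a tau_m1 x_m1 x 0 - x 0 = 0"
      using ppa_v_0[of tau_m1 a x] tau x_m1 by simp
    show "ppa_v a tau_m1 x_m1 x (Suc k) - x (Suc k) = (a * real k) *\<^sub>R (x (Suc k) - x k)" for k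
      by (simp add: ppa_v_Suc[OF a])
    show "0 \<le> (x (Suc k) - x k) \<bullet> (yosida lam T (x (Suc k)) - yosida lam T (x k))" for k
      using yosida_cocoercive[OF max lam, of "x (Suc k)" "x k"] lam
      by (smt (verit) mult_nonneg_nonneg zero_le_power2)
    fix k
    have s: "0 < a * real k + 1" using a by (simp add: add_nonneg_pos)
    have 1: "1 / ppa_tau a k powr p = (a * real k + 1) powr p"
      using s by (simp add: ppa_tau_def powr_divide)
    have 2: "(1 - ppa_tau a k) / ppa_tau a k powr p = a * real k * (a * real k + 1) powr (p - 1)"
    proof -
      have "(1 - ppa_tau a k) / ppa_tau a k powr p = (1 - ppa_tau a k) * (a * real k + 1) powr p"
        by (simp only: 1[symmetric] times_divide_eq_right mult_1_right)
      also have "\<dots> = a * real k / (a * real k + 1) * (a * real k + 1) powr p"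
        using s by (simp add: ppa_tau_def field_simps)
      also have "\<dots> = a * real k * (a * real k + 1) powr (p - 1)"
        using s by (simp add: powr_diff)
      finally show ?thesis .
    qed
    show "(a * real k + 1) powr p *\<^sub>R yosida lam T (x (Suc k))
      - (a * real k * (a * real k + 1) powr (p - 1)) *\<^sub>R yosida lam T (x k)
      + (ppa_v a tau_m1 x_m1 x (Suc k) - x (Suc k) - (ppa_v a tau_m1 x_m1 x k - x k))
      + (1 + beta) *\<^sub>R (x (Suc k) - x k) + g k = 0"
      using step[of k] unfolding 1 2 by (simp add: algebra_simps)
  qed (use a p mu beta delta in auto)
qed

theorem theorem5:
  fixes T :: "'a::{real_inner, complete_space} \<Rightarrow> 'a set"
    and mu p a tau_m1 lam beta :: real
    and delta :: "nat \<Rightarrow> real"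
    and g x :: "nat \<Rightarrow> 'a"
    and x_m1 :: 'a
  assumes "maximally_monotone T"
    and "op_inverse T 0 \<noteq> {}"
    and "bounded (op_inverse T 0)"
    and "0 < mu" and "mu < 1"
    and "0 < beta"
    and "sublinear_contracting_ppa T mu p a tau_m1 lam beta delta g x_m1 x"
  shows "\<exists>z. 0 \<in> T z \<and> converges_weakly x z"
proof -
  note max = assms(1)
  have lam: "0 < lam"
    using assms(7) by (simp add: sublinear_contracting_ppa_def)
  define A where "A = (\<lambda>k. yosida lam T (x k))"
  interpret contracting_recursion a mu p beta x A "\<lambda>k. ppa_v a tau_m1 x_m1 x k - x k" g delta
    unfolding A_def using assms by (intro sublinear_ppa_imp_contracting_recursion)
  have pairing: "lam * (norm (A k))\<^sup>2 \<le> (x k - z) \<bullet> A k" if "0 \<in> T z" for z k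
    using yosida_cocoercive[OF max lam, of "x k" z] yosida_zero[OF max lam that] by (simp add: A_def)
  obtain z0 where z0: "0 \<in> T z0"
    using assms(2) by (auto simp: op_inverse_def)
  have bnd: "bounded (range x)"
    using bounded_iterates[OF lam pairing[OF z0]] .
  have A0: "A \<longlonglongrightarrow> 0"
    using residual_tendsto_0[OF lam pairing[OF z0]] .
  have "\<exists>z\<in>{z. 0 \<in> T z}. \<forall>y. (\<lambda>k. x k \<bullet> y) \<longlonglongrightarrow> z \<bullet> y"
  proof (rule opial[OF bnd])
    fix z assume "z \<in> {z. 0 \<in> T z}"
    then show "convergent (\<lambda>k. (norm (x k - z))\<^sup>2)"
      using distance_convergent[OF lam pairing] by simp
  next
    fix \<sigma> :: "nat \<Rightarrow> nat" and w
    assume \<sigma>: "strict_mono \<sigma>"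
      and w: "\<And>y c. \<forall>\<^sub>F k in sequentially. x (\<sigma> k) \<bullet> y \<le> c \<Longrightarrow> w \<bullet> y \<le> c"
    have "bounded (range (\<lambda>k. x (\<sigma> k)))"
      using bnd by (rule bounded_subset) auto
    moreover have "(\<lambda>k. yosida lam T (x (\<sigma> k))) \<longlonglongrightarrow> 0"
      using LIMSEQ_subseq_LIMSEQ[OF A0 \<sigma>] by (simp add: A_def o_def)
    ultimately have "0 \<in> T w"
      using zero_if_yosida_tendsto_zero[OF max lam _ _ w] by blast
    then show "w \<in> {z. 0 \<in> T z}" by simp
  qed
  then show ?thesis by (auto simp: converges_weakly_def)
qed

end
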